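(* Let $\mathcal{X}=(x_n)_{n=1}^\infty$ be a truncation quasi-greedy basis of a quasi-Banach space $\mathbb{X}$. Then $\mathcal{X}$ is nearly unconditional.
   Context: $\mathbb{X}$ is an infinite-dimensional separable quasi-Banach space over the real or complex field. A basis of $\mathbb{X}$ is a norm-bounded sequence $\mathcal{X}=(x_n)_{n=1}^\infty$ with $\overline{\mathrm{span}}(x_n: n\in\mathbb{N})=\mathbb{X}$ for which there is a (unique) norm-bounded sequence $(x_n^* )_{n=1}^\infty$ in $\mathbb{X}^*$ such that $(x_n,x_n^* )_{n=1}^\infty$ is a biorthogonal system. For finite $A\subseteq\mathbb{N}$, $S_A(f)=\sum_{n\in A}x_n^*(f)\,x_n$. A greedy set of $f\in\mathbb{X}$ of cardinality $m$ is a set $A\subseteq\mathbb{N}$ with $|A|=m$ such that $|x_n^*(f)|\ge|x_k^*(f)|$ whenever $n\in A$ and $k\notin A$. For finite $A\subseteq\mathbb{N}$ let $$\mathcal{R}(f,A)=\min_{n\in A}|x_n^*(f)|\sum_{n\in A}\mathrm{sign}(x_n^*(f))\,x_n,$$ where $\mathrm{sign}(z)=z/|z|$ for $z\neq 0$. The $m$th restricted truncation operator is $\mathcal{R}_m(f)=\mathcal{R}(f,A)$, where $A$ is any greedy set of $f$ of cardinality $m$. The basis is truncation quasi-greedy if $\sup_{m\in\mathbb{N}}\|\mathcal{R}_m\|<\infty$, i.e., there is a constant $C$ such that $\|\mathcal{R}(f,A)\|\le C\|f\|$ for all $f\in\mathbb{X}$, all $m\in\mathbb{N}$ and every greedy set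 $A$ of $f$ of cardinality $m$. The basis is nearly unconditional if for each $a\in(0,1)$ there is a constant $C$ such that $\|S_A(f)\|\le C\|f\|$ for all $f\in\mathbb{X}$ with $\sup_n|x_n^*(f)|\le1$ and all $A\subseteq\{n\in\mathbb{N}: |x_n^*(f)|\ge a\}$. *)

theory Defs
  imports Complex_Main "HOL-Library.Countable_Set"
begin

text \<open>
  The scalar field is a type of class \<^class>\<open>real_normed_field\<close>. Both \<^typ>\<open>real\<close> and
  \<^typ>\<open>complex\<close> belong to this class, and by the Gelfand-Mazur theorem every member is isometrically
  isomorphic to one of the two. The quasi-norm is a parameter, since the library's normed space
  classes require the triangle inequality with constant 1.
\<close>

locale quasi_banach_space = vector_space smul
  for smul :: "'k::real_normed_field \<Rightarrow> 'a::ab_group_add \<Rightarrow> 'a" +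
  fixes qnorm :: "'a \<Rightarrow> real"
  assumes qnorm_nonneg: "0 \<le> qnorm f"
    and qnorm_eq_0_iff: "qnorm f = 0 \<longleftrightarrow> f = 0"
    and qnorm_scale: "qnorm (smul c f) = norm c * qnorm f"
    and quasi_triangle: "\<exists>\<kappa>\<ge>1. \<forall>f g. qnorm (f + g) \<le> \<kappa> * (qnorm f + qnorm g)"
    and qnorm_complete:
      "(\<forall>e>0. \<exists>N. \<forall>m\<ge>N. \<forall>n\<ge>N. qnorm (u m - u n) < e) \<Longrightarrow> \<exists>f. (\<lambda>n. qnorm (u n - f)) \<longlonglongrightarrow> 0"

definition infinite_dimensional :: "('k::field \<Rightarrow> 'a::ab_group_add \<Rightarrow> 'a) \<Rightarrow> bool" where
  "infinite_dimensional smul \<longleftrightarrow> \<not> (\<exists>B. finite B \<and> module.span smul B = UNIV)"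

definition qclosure :: "('a::ab_group_add \<Rightarrow> real) \<Rightarrow> 'a set \<Rightarrow> 'a set" where
  "qclosure qnorm S = {f. \<forall>e>0. \<exists>g\<in>S. qnorm (f - g) < e}"

definition qseparable :: "('a::ab_group_add \<Rightarrow> real) \<Rightarrow> bool" where
  "qseparable qnorm \<longleftrightarrow> (\<exists>D. countable D \<and> qclosure qnorm D = UNIV)"

definition dual_space ::
  "('k::real_normed_field \<Rightarrow> 'a::ab_group_add \<Rightarrow> 'a) \<Rightarrow> ('a \<Rightarrow> real) \<Rightarrow> ('a \<Rightarrow> 'k) set" where
  "dual_space smul qnorm =
    {\<phi>. Vector_Spaces.linear smul (*) \<phi> \<and> (\<exists>C. \<forall>f. norm (\<phi> f) \<le> C * qnorm f)}"

text \<open>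
  The coordinate functionals \<open>xs n\<close> are carried along with the basis \<open>x\<close>; they are determined by
  it, see \<open>is_basis_unique\<close>. The last conjunct says that the dual norms of
  the \<open>xs n\<close> are bounded by one constant. Sequences are indexed from 0.
\<close>

definition is_basis ::
  "('k::real_normed_field \<Rightarrow> 'a::ab_group_add \<Rightarrow> 'a) \<Rightarrow> ('a \<Rightarrow> real)
    \<Rightarrow> (nat \<Rightarrow> 'a) \<Rightarrow> (nat \<Rightarrow> 'a \<Rightarrow> 'k) \<Rightarrow> bool" where
  "is_basis smul qnorm x xs \<longleftrightarrow>
    (\<exists>C. \<forall>n. qnorm (x n) \<le> C) \<and>
    qclosure qnorm (module.span smul (range x)) = UNIV \<and>
    (\<forall>n. xs n \<in> dual_space smul qnorm) \<and>
    (\<forall>n k. xs n (x k) = (if n = k then 1 else 0)) \<and>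
    (\<exists>C. \<forall>n f. norm (xs n f) \<le> C * qnorm f)"

definition coord_proj ::
  "('k::field \<Rightarrow> 'a::ab_group_add \<Rightarrow> 'a) \<Rightarrow> (nat \<Rightarrow> 'a) \<Rightarrow> (nat \<Rightarrow> 'a \<Rightarrow> 'k)
    \<Rightarrow> nat set \<Rightarrow> 'a \<Rightarrow> 'a" where
  "coord_proj smul x xs A f = (\<Sum>n\<in>A. smul (xs n f) (x n))"

definition greedy_set ::
  "(nat \<Rightarrow> 'a \<Rightarrow> 'k::real_normed_field) \<Rightarrow> 'a \<Rightarrow> nat \<Rightarrow> nat set \<Rightarrow> bool" where
  "greedy_set xs f m A \<longleftrightarrow>
    finite A \<and> card A = m \<and> (\<forall>n\<in>A. \<forall>k. k \<notin> A \<longrightarrow> norm (xs n f) \<ge> norm (xs k f))"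

text \<open>
  For \<open>A = {}\<close> the minimum is unspecified, but it multiplies an empty sum, so the value is \<open>0\<close>.
  The convention \<open>sgn 0 = 0\<close> is immaterial: if some coefficient on \<open>A\<close> is \<open>0\<close>, so is the minimum.
\<close>

definition restricted_truncation ::
  "('k::real_normed_field \<Rightarrow> 'a::ab_group_add \<Rightarrow> 'a) \<Rightarrow> (nat \<Rightarrow> 'a) \<Rightarrow> (nat \<Rightarrow> 'a \<Rightarrow> 'k)
    \<Rightarrow> 'a \<Rightarrow> nat set \<Rightarrow> 'a" where
  "restricted_truncation smul x xs f A =
    smul (of_real (Min ((\<lambda>n. norm (xs n f)) ` A))) (\<Sum>n\<in>A. smul (sgn (xs n f)) (x n))"

definition truncation_quasi_greedy ::
  "('k::real_normed_field \<Rightarrow> 'a::ab_group_add \<Rightarrow> 'a) \<Rightarrow> ('a \<Rightarrow> real)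
    \<Rightarrow> (nat \<Rightarrow> 'a) \<Rightarrow> (nat \<Rightarrow> 'a \<Rightarrow> 'k) \<Rightarrow> bool" where
  "truncation_quasi_greedy smul qnorm x xs \<longleftrightarrow>
    (\<exists>C. \<forall>f m A. greedy_set xs f m A \<longrightarrow>
      qnorm (restricted_truncation smul x xs f A) \<le> C * qnorm f)"

text \<open>
  No finiteness of \<open>A\<close> is assumed: for a basis the coefficients of every vector tend to \<open>0\<close>, so the
  sets \<open>A\<close> below are automatically finite and \<^const>\<open>coord_proj\<close> is a genuine finite sum.
\<close>

definition nearly_unconditional ::
  "('k::real_normed_field \<Rightarrow> 'a::ab_group_add \<Rightarrow> 'a) \<Rightarrow> ('a \<Rightarrow> real)
    \<Rightarrow> (nat \<Rightarrow> 'a) \<Rightarrow> (nat \<Rightarrow> 'a \<Rightarrow> 'k) \<Rightarrow> bool" where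
  "nearly_unconditional smul qnorm x xs \<longleftrightarrow>
    (\<forall>a::real. 0 < a \<and> a < 1 \<longrightarrow>
      (\<exists>C. \<forall>f A. (\<forall>n. norm (xs n f) \<le> 1) \<and> A \<subseteq> {n. norm (xs n f) \<ge> a} \<longrightarrow>
        qnorm (coord_proj smul x xs A f) \<le> C * qnorm f))"

lemma is_basis_unique:
  assumes Q: "quasi_banach_space smul qnorm"
    and B1: "is_basis smul qnorm x xs" and B2: "is_basis smul qnorm x ys"
  shows "xs = ys"
proof (intro ext)
  fix n f
  interpret quasi_banach_space smul qnorm by (rule Q)
  have L1: "Vector_Spaces.linear smul (*) (xs n)" and L2: "Vector_Spaces.linear smul (*) (ys n)"
    using B1 B2 by (auto simp: is_basis_def dual_space_def)
  interpret l1: Vector_Spaces.linear smul "(*)" "xs n" by (rule L1)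
  interpret l2: Vector_Spaces.linear smul "(*)" "ys n" by (rule L2)
  obtain C1 C2 where C: "\<And>g. norm (xs n g) \<le> C1 * qnorm g" "\<And>g. norm (ys n g) \<le> C2 * qnorm g"
    using B1 B2 unfolding is_basis_def by metis
  have eq: "xs n g = ys n g" if "g \<in> span (range x)" for g
    using that
  proof (induction rule: span_induct_alt)
    case base
    show ?case by (simp add: l1.zero l2.zero)
  next
    case (step c v w)
    then show ?case
      using B1 B2 by (auto simp: l1.add l2.add l1.scale l2.scale is_basis_def)
  qed
  define D where "D = \<bar>C1\<bar> + \<bar>C2\<bar> + 1"
  have "D > 0" by (simp add: D_def)
  have "norm (xs n f - ys n f) \<le> 0 + e" if "e > 0" for e
  proof -
    have "f \<in> qclosure qnorm (span (range x))"
      using B1 by (simp add: is_basis_def)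
    moreover have "e / D > 0" using \<open>D > 0\<close> that by simp
    ultimately obtain g where g: "g \<in> span (range x)" "qnorm (f - g) < e / D"
      by (auto simp: qclosure_def)
    have "norm (xs n f - ys n f) = norm (xs n (f - g) - ys n (f - g))"
      using eq[OF g(1)] by (simp add: l1.diff l2.diff)
    also have "\<dots> \<le> C1 * qnorm (f - g) + C2 * qnorm (f - g)"
      using C[of "f - g"] norm_triangle_ineq4[of "xs n (f - g)" "ys n (f - g)"] by linarith
    also have "\<dots> \<le> D * qnorm (f - g)"
      unfolding D_def distrib_right[symmetric]
      by (rule mult_right_mono) (use qnorm_nonneg in auto)
    also have "\<dots> \<le> e"
      using g(2) \<open>D > 0\<close> by (simp add: field_simps)
    finally show ?thesis by simp
  qed
  then have "norm (xs n f - ys n f) \<le> 0" by (rule field_le_epsilon)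
  then show "xs n f = ys n f" by simp
qed

end

theory Submission
  imports Defs
begin

text \<open>
  For \<open>f\<close> with coefficients bounded by 1, the set \<open>B = {n. \<bar>x\<^sub>n\<^sup>*(f)\<bar> \<ge> a}\<close> is itself a greedy set of \<open>f\<close>,
  so truncation quasi-greediness bounds the signed sum of \<open>x\<^sub>n\<close> over \<open>B\<close> by \<open>\<parallel>f\<parallel> / a\<close>, up to a
  constant. Every subset of \<open>B\<close> is a greedy set of that signed sum, so all its partial sums obey
  the same bound. The vector \<open>S\<^sub>A(f)\<close> arises from these by multipliers in \<open>[0, 1]\<close>, which cost
  another constant.
\<close>

context quasi_banach_space
begin

section \<open>Scalar multipliers in a quasi-normed space\<close>

lemma qnorm_zero [simp]: "qnorm 0 = 0"
  by (simp add: qnorm_eq_0_iff)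

text \<open>Adding one vector costs one use of the quasi-triangle inequality. The bound may depend
  on \<open>A\<close> and \<open>y\<close> and grows with the size of \<open>A\<close>; it only
  serves to make the supremum in \<open>qnorm_multipliers_le\<close> a real number.\<close>

lemma bdd_above_qnorm_multipliers:
  assumes "finite A"
  shows "\<exists>b. \<forall>c :: 'i \<Rightarrow> real. (\<forall>i\<in>A. 0 \<le> c i \<and> c i \<le> 1) \<longrightarrow>
           qnorm (\<Sum>i\<in>A. smul (of_real (c i)) (y i)) \<le> b"
  using assms
proof (induction A rule: finite_induct)
  case empty
  show ?case by (intro exI[of _ 0]) simp
next
  case (insert j A)
  obtain \<kappa> where \<kappa>: "\<kappa> \<ge> 1" "\<And>f g. qnorm (f + g) \<le> \<kappa> * (qnorm f + qnorm g)"
    using quasi_triangle by blast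
  obtain b where b: "\<And>c :: 'i \<Rightarrow> real. (\<forall>i\<in>A. 0 \<le> c i \<and> c i \<le> 1) \<Longrightarrow>
      qnorm (\<Sum>i\<in>A. smul (of_real (c i)) (y i)) \<le> b"
    using insert.IH by blast
  show ?case
  proof (intro exI allI impI)
    fix c :: "'i \<Rightarrow> real"
    assume c: "\<forall>i\<in>insert j A. 0 \<le> c i \<and> c i \<le> 1"
    have "qnorm (\<Sum>i\<in>insert j A. smul (of_real (c i)) (y i))
        \<le> \<kappa> * (qnorm (smul (of_real (c j)) (y j)) + qnorm (\<Sum>i\<in>A. smul (of_real (c i)) (y i)))"
      using insert.hyps \<kappa>(2) by simp
    also have "\<dots> \<le> \<kappa> * (qnorm (y j) + b)"
      using \<kappa>(1) c b[of c]
      by (intro mult_left_mono add_mono) (auto simp: qnorm_scale qnorm_nonneg mult_left_le_one_le)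
    finally show "qnorm (\<Sum>i\<in>insert j A. smul (of_real (c i)) (y i)) \<le> \<kappa> * (qnorm (y j) + b)" .
  qed
qed

text \<open>The vector \<open>r\<close> is the fractional part of \<open>c\<close>; the integer part is peeled off one unit at a time.\<close>

lemma qnorm_integer_part_le:
  obtains k where "k \<ge> 0" and "\<forall>(A :: 'i set) y L c. finite A \<longrightarrow>
      (\<forall>E\<subseteq>A. qnorm (\<Sum>i\<in>E. y i) \<le> L) \<longrightarrow> (\<forall>i\<in>A. 0 \<le> c i \<and> c i \<le> 1 + real m) \<longrightarrow>
      (\<exists>r. (\<forall>i\<in>A. 0 \<le> r i \<and> r i \<le> 1) \<and>
         qnorm (\<Sum>i\<in>A. smul (of_real (c i - r i)) (y i)) \<le> k * L)"
proof (induction m arbitrary: thesis)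
  case 0
  \<comment> \<open>Multipliers already in [0, 1] are their own remainder, so
    \<open>k = 0\<close>.\<close>
  have "\<exists>r. (\<forall>i\<in>A. 0 \<le> r i \<and> r i \<le> 1) \<and>
         qnorm (\<Sum>i\<in>A. smul (of_real (c i - r i)) (y i)) \<le> 0 * L"
    if "\<forall>i\<in>A. 0 \<le> c i \<and> c i \<le> 1 + real 0" for A :: "'i set" and y L and c
    using that by (intro exI[of _ c]) auto
  then show ?case by (intro 0[OF order_refl]) blast
next
  case (Suc m)
  obtain \<kappa> where \<kappa>: "\<kappa> \<ge> 1" "\<And>f g. qnorm (f + g) \<le> \<kappa> * (qnorm f + qnorm g)"
    using quasi_triangle by blast
  obtain k where k: "k \<ge> 0" and IH: "\<forall>(A :: 'i set) y L c. finite A \<longrightarrow>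
      (\<forall>E\<subseteq>A. qnorm (\<Sum>i\<in>E. y i) \<le> L) \<longrightarrow> (\<forall>i\<in>A. 0 \<le> c i \<and> c i \<le> 1 + real m) \<longrightarrow>
      (\<exists>r. (\<forall>i\<in>A. 0 \<le> r i \<and> r i \<le> 1) \<and>
         qnorm (\<Sum>i\<in>A. smul (of_real (c i - r i)) (y i)) \<le> k * L)"
    by (rule Suc.IH)
  have "\<exists>r. (\<forall>i\<in>A. 0 \<le> r i \<and> r i \<le> 1) \<and>
         qnorm (\<Sum>i\<in>A. smul (of_real (c i - r i)) (y i)) \<le> \<kappa> * (k + 1) * L"
    if A: "finite A" and L: "\<forall>E\<subseteq>A. qnorm (\<Sum>i\<in>E. y i) \<le> L"
      and c: "\<forall>i\<in>A. 0 \<le> c i \<and> c i \<le> 1 + real (Suc m)" for A :: "'i set" and y L c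
  proof -
    \<comment> \<open>One unit is removed exactly where \<open>c i \<ge> 1\<close>, so
      \<open>c'\<close> stays nonnegative and is at most \<open>1 + real m\<close>. The removed part
      is the plain sum over \<open>E \<subseteq> A\<close>, bounded by \<open>L\<close>; this is the
      \<open>+ 1\<close> in the new constant.\<close>
    define E where "E = {i\<in>A. c i \<ge> 1}"
    define c' where "c' i = c i - (if i \<in> E then 1 else 0)" for i
    have "\<forall>i\<in>A. 0 \<le> c' i \<and> c' i \<le> 1 + real m"
      using c by (auto simp: c'_def E_def)
    from IH[THEN spec, THEN spec, THEN spec, THEN spec, THEN mp, THEN mp, THEN mp, OF A L this]
    obtain r where r: "\<forall>i\<in>A. 0 \<le> r i \<and> r i \<le> 1"
      and rL: "qnorm (\<Sum>i\<in>A. smul (of_real (c' i - r i)) (y i)) \<le> k * L"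
      by blast
    have "(\<Sum>i\<in>A. smul (of_real (c i - r i)) (y i))
        = (\<Sum>i\<in>A. smul (of_real (c' i - r i)) (y i) + (if i \<in> E then y i else 0))"
      by (intro sum.cong refl) (auto simp: c'_def scale_left_diff_distrib)
    also have "\<dots> = (\<Sum>i\<in>A. smul (of_real (c' i - r i)) (y i)) + (\<Sum>i\<in>E. y i)"
      unfolding sum.distrib E_def using A by (simp add: sum.inter_filter)
    finally have "qnorm (\<Sum>i\<in>A. smul (of_real (c i - r i)) (y i))
        \<le> \<kappa> * (qnorm (\<Sum>i\<in>A. smul (of_real (c' i - r i)) (y i)) + qnorm (\<Sum>i\<in>E. y i))"
      using \<kappa>(2) by simp
    also have "\<dots> \<le> \<kappa> * (k * L + L)"
      using rL L \<kappa>(1) by (intro mult_left_mono add_mono) (auto simp: E_def)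
    finally show ?thesis using r by (auto simp: algebra_simps)
  qed
  moreover have "\<kappa> * (k + 1) \<ge> 0" using k \<kappa>(1) by simp
  ultimately show ?case by (intro Suc.prems) blast+
qed

text \<open>
  Without local convexity, extreme points do not help. Instead, \<open>c\<close> is split as a multiple of
  \<open>1/M\<close> plus a remainder in \<open>[0, 1/M]\<close>; when \<open>M \<ge> 2\<kappa>\<close>, the remainder is absorbed by half of the
  supremum to be bounded.
\<close>

lemma qnorm_multipliers_le:
  obtains k where "k \<ge> 0" and "\<forall>(A :: 'i set) y L c. finite A \<longrightarrow>
      (\<forall>E\<subseteq>A. qnorm (\<Sum>i\<in>E. y i) \<le> L) \<longrightarrow> (\<forall>i\<in>A. 0 \<le> c i \<and> c i \<le> 1) \<longrightarrow>
      qnorm (\<Sum>i\<in>A. smul (of_real (c i)) (y i)) \<le> k * L"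
proof -
  obtain \<kappa> where \<kappa>: "\<kappa> \<ge> 1" "\<And>f g. qnorm (f + g) \<le> \<kappa> * (qnorm f + qnorm g)"
    using quasi_triangle by blast
  obtain m :: nat where m: "real m \<ge> 2 * \<kappa>"
    using real_arch_simple by blast
  \<comment> \<open>This form lets \<open>qnorm_integer_part_le\<close> apply to the multipliers
    \<open>M * c i\<close> in [0, M].\<close>
  define M where "M = 1 + real m"
  have M: "M > 0" "2 * \<kappa> \<le> M" using m by (auto simp: M_def)
  obtain k where k: "k \<ge> 0" and split: "\<forall>(A :: 'i set) y L c. finite A \<longrightarrow>
      (\<forall>E\<subseteq>A. qnorm (\<Sum>i\<in>E. y i) \<le> L) \<longrightarrow> (\<forall>i\<in>A. 0 \<le> c i \<and> c i \<le> M) \<longrightarrow>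
      (\<exists>r. (\<forall>i\<in>A. 0 \<le> r i \<and> r i \<le> 1) \<and>
         qnorm (\<Sum>i\<in>A. smul (of_real (c i - r i)) (y i)) \<le> k * L)"
    by (unfold M_def, rule qnorm_integer_part_le)
  have "qnorm (\<Sum>i\<in>A. smul (of_real (c i)) (y i)) \<le> k * L"
    if A: "finite A" and L: "\<forall>E\<subseteq>A. qnorm (\<Sum>i\<in>E. y i) \<le> L"
      and c: "\<forall>i\<in>A. 0 \<le> c i \<and> c i \<le> 1" for A :: "'i set" and y L c
  proof -
    define V where "V c = qnorm (\<Sum>i\<in>A. smul (of_real (c i)) (y i))" for c :: "'i \<Rightarrow> real"
    define C where "C = {c :: 'i \<Rightarrow> real. \<forall>i\<in>A. 0 \<le> c i \<and> c i \<le> 1}"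
    define T where "T = (SUP c\<in>C. V c)"
    have bdd: "bdd_above (V ` C)"
      using bdd_above_qnorm_multipliers[OF A, of y] by (auto simp: bdd_above_def V_def C_def)
    have le_T: "V c \<le> T" if "c \<in> C" for c
      unfolding T_def using that bdd by (rule cSUP_upper)
    have step: "V c \<le> (k * L + T) / 2" if "c \<in> C" for c
    proof -
      have "\<forall>i\<in>A. 0 \<le> M * c i \<and> M * c i \<le> M"
        using that M by (auto simp: C_def mult_left_le)
      from split[THEN spec, THEN spec, THEN spec, THEN spec, THEN mp, THEN mp, THEN mp, OF A L this]
      obtain r where r: "r \<in> C"
        and rL: "qnorm (\<Sum>i\<in>A. smul (of_real (M * c i - r i)) (y i)) \<le> k * L"
        unfolding C_def mem_Collect_eq by blast
      have "smul (of_real M) (\<Sum>i\<in>A. smul (of_real (c i)) (y i))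
          = (\<Sum>i\<in>A. smul (of_real (M * c i - r i)) (y i)) + (\<Sum>i\<in>A. smul (of_real (r i)) (y i))"
        by (simp add: scale_sum_right sum.distrib[symmetric] scale_left_distrib[symmetric])
      moreover have "M * V c = qnorm (smul (of_real M) (\<Sum>i\<in>A. smul (of_real (c i)) (y i)))"
        using M(1) by (simp add: V_def qnorm_scale)
      ultimately have "M * V c \<le> \<kappa> * (qnorm (\<Sum>i\<in>A. smul (of_real (M * c i - r i)) (y i)) + V r)"
        by (simp only: V_def \<kappa>(2))
      also have "\<dots> \<le> \<kappa> * (k * L + T)"
        using rL le_T[OF r] \<kappa>(1) by (intro mult_left_mono add_mono) auto
      also have "\<dots> \<le> M / 2 * (k * L + T)"
      proof (rule mult_right_mono)
        \<comment> \<open>The sign of \<open>k * L\<close> is read off from the norm that it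
          bounds.\<close>
        have "0 \<le> k * L" by (rule order_trans[OF qnorm_nonneg rL])
        moreover have "0 \<le> T" using le_T[OF r] qnorm_nonneg unfolding V_def by (rule order_trans[rotated])
        ultimately show "0 \<le> k * L + T" by simp
      qed (use M in simp)
      finally have "M * V c \<le> M * ((k * L + T) / 2)" by simp
      then show ?thesis using M(1) by (simp only: mult_le_cancel_left_pos)
    qed
    have "c \<in> C" using c by (simp add: C_def)
    \<comment> \<open>Supremum of \<open>step\<close> over \<open>C\<close>, which is nonempty since
      it contains \<open>c\<close>. As \<open>T\<close> is finite, this rearranges to
      \<open>T \<le> k * L\<close>.\<close>
    then have "T \<le> (k * L + T) / 2"
      unfolding T_def[symmetric] using step by (subst T_def, intro cSUP_least) auto
    then show ?thesis using le_T[OF \<open>c \<in> C\<close>] by (simp add: V_def)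
  qed
  then show ?thesis by (intro that[OF k]) blast
qed

section \<open>Coefficients and signed sums of a basis\<close>

text \<open>Approximate \<open>f\<close> by a \<open>g\<close> in the span, which has finitely many
  nonzero coefficients. Where those of \<open>g\<close> vanish, those of \<open>f\<close> are below
  \<open>a\<close>.\<close>

lemma finite_large_coefficients:
  assumes "is_basis smul qnorm x xs" and "a > 0"
  shows "finite {n. norm (xs n f) \<ge> a}"
proof -
  have lin: "Vector_Spaces.linear smul (*) (xs n)" for n
    using assms(1) by (auto simp: is_basis_def dual_space_def)
  obtain C where C: "\<And>n g. norm (xs n g) \<le> C * qnorm g"
    using assms(1) unfolding is_basis_def by blast
  have supp: "finite {n. xs n g \<noteq> 0}" if "g \<in> span (range x)" for g
    using that
  proof (induction rule: span_induct_alt)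
    case base
    have "xs n 0 = 0" for n
    proof -
      interpret l: Vector_Spaces.linear smul "(*)" "xs n" by (rule lin)
      show ?thesis by (rule l.zero)
    qed
    then show ?case by simp
  next
    case (step c v w)
    obtain j where "v = x j" using step by blast
    have "xs n (smul c v + w) = c * xs n (x j) + xs n w" for n
    proof -
      interpret l: Vector_Spaces.linear smul "(*)" "xs n" by (rule lin)
      show ?thesis by (simp add: l.add l.scale \<open>v = x j\<close>)
    qed
    then have "{n. xs n (smul c v + w) \<noteq> 0} \<subseteq> insert j {n. xs n w \<noteq> 0}"
      using assms(1) by (auto simp: is_basis_def)
    then show ?case using step finite_subset by blast
  qed
  \<comment> \<open>Since \<open>C\<close> bounds all coordinate functionals, one \<open>e\<close>
    serves every \<open>n\<close>; the \<open>+ 1\<close> keeps the denominator positive.\<close>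
  define e where "e = a / (\<bar>C\<bar> + 1)"
  have "e > 0" using assms(2) by (simp add: e_def)
  moreover have "f \<in> qclosure qnorm (span (range x))"
    using assms(1) by (simp add: is_basis_def)
  ultimately obtain g where g: "g \<in> span (range x)" "qnorm (f - g) < e"
    by (auto simp: qclosure_def)
  have small: "norm (xs n (f - g)) < a" for n
  proof -
    have "norm (xs n (f - g)) \<le> (\<bar>C\<bar> + 1) * qnorm (f - g)"
      by (rule order_trans[OF C mult_right_mono]) (auto simp: qnorm_nonneg)
    also have "\<dots> < a" using g(2) by (simp add: e_def field_simps)
    finally show ?thesis .
  qed
  have "{n. norm (xs n f) \<ge> a} \<subseteq> {n. xs n g \<noteq> 0}"
  proof (intro subsetI CollectI notI)
    fix n assume n: "n \<in> {n. norm (xs n f) \<ge> a}" "xs n g = 0"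
    interpret l: Vector_Spaces.linear smul "(*)" "xs n" by (rule lin)
    show False using small[of n] n by (simp add: l.diff)
  qed
  then show ?thesis using supp[OF g(1)] finite_subset by blast
qed

text \<open>The signed sum over \<open>B\<close> has coefficients of modulus 1 on \<open>B\<close>
  and 0 elsewhere. Ties make every \<open>E \<subseteq> B\<close> greedy for it, and its restricted
  truncation to \<open>E\<close> is the signed sum over \<open>E\<close>.\<close>

lemma truncation_bound_signed_sum_subset:
  assumes basis: "is_basis smul qnorm x xs"
    and C: "\<And>f m A. greedy_set xs f m A \<Longrightarrow> qnorm (restricted_truncation smul x xs f A) \<le> C * qnorm f"
    and B: "finite B" and E: "E \<subseteq> B" and \<epsilon>: "\<And>n. n \<in> B \<Longrightarrow> norm (\<epsilon> n) = 1" and "C \<ge> 0"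
  shows "qnorm (\<Sum>n\<in>E. smul (\<epsilon> n) (x n)) \<le> C * qnorm (\<Sum>n\<in>B. smul (\<epsilon> n) (x n))"
\<comment> \<open>The minimum in the truncation equals 1 only for nonempty \<open>E\<close>.\<close>
proof (cases "E = {}")
  case True
  then show ?thesis using \<open>C \<ge> 0\<close> by (simp add: qnorm_nonneg)
next
  case False
  define g where "g = (\<Sum>n\<in>B. smul (\<epsilon> n) (x n))"
  have coeff: "xs n g = (if n \<in> B then \<epsilon> n else 0)" for n
  proof -
    interpret l: Vector_Spaces.linear smul "(*)" "xs n"
      using basis by (auto simp: is_basis_def dual_space_def)
    have "xs n g = (\<Sum>k\<in>B. if n = k then \<epsilon> k else 0)"
      using basis unfolding g_def l.sum by (intro sum.cong) (auto simp: l.scale is_basis_def)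
    then show ?thesis using B by simp
  qed
  have on_E: "norm (xs n g) = 1 \<and> sgn (xs n g) = \<epsilon> n" if "n \<in> E" for n
    using that E \<epsilon>[of n] by (auto simp: coeff sgn_div_norm)
  have "greedy_set xs g (card E) E"
    using E B \<epsilon> finite_subset[OF E B] by (auto simp: greedy_set_def coeff)
  moreover have "(\<lambda>n. norm (xs n g)) ` E = {1}"
    using False on_E by force
  then have "restricted_truncation smul x xs g E = (\<Sum>n\<in>E. smul (\<epsilon> n) (x n))"
    using on_E by (simp add: restricted_truncation_def)
  ultimately show ?thesis using C by (metis g_def)
qed

end

theorem theorem3p5:
  fixes smul :: "'k::real_normed_field \<Rightarrow> 'a::ab_group_add \<Rightarrow> 'a"
    and qnorm :: "'a \<Rightarrow> real"
    and x :: "nat \<Rightarrow> 'a"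
    and xs :: "nat \<Rightarrow> 'a \<Rightarrow> 'k"
  assumes "quasi_banach_space smul qnorm"
    and "infinite_dimensional smul"
    and "qseparable qnorm"
    and "is_basis smul qnorm x xs"
    and "truncation_quasi_greedy smul qnorm x xs"
  shows "nearly_unconditional smul qnorm x xs"
proof -
  interpret quasi_banach_space smul qnorm by (rule assms(1))
  note basis = assms(4)
  obtain C0 where C0: "\<And>f m A. greedy_set xs f m A \<Longrightarrow>
      qnorm (restricted_truncation smul x xs f A) \<le> C0 * qnorm f"
    using assms(5) unfolding truncation_quasi_greedy_def by blast
  \<comment> \<open>A nonnegative constant, so that inequalities can be multiplied by it.\<close>
  define C where "C = \<bar>C0\<bar>"
  have C: "qnorm (restricted_truncation smul x xs f A) \<le> C * qnorm f"
    if "greedy_set xs f m A" for f m A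
    unfolding C_def
    by (rule order_trans[OF C0[OF that] mult_right_mono]) (auto simp: qnorm_nonneg)
  have "C \<ge> 0" by (simp add: C_def)
  obtain k where k: "k \<ge> 0" and mult: "\<forall>(A :: nat set) y L c. finite A \<longrightarrow>
      (\<forall>E\<subseteq>A. qnorm (\<Sum>i\<in>E. y i) \<le> L) \<longrightarrow> (\<forall>i\<in>A. 0 \<le> c i \<and> c i \<le> 1) \<longrightarrow>
      qnorm (\<Sum>i\<in>A. smul (of_real (c i)) (y i)) \<le> k * L"
    by (rule qnorm_multipliers_le)
  \<comment> \<open>Read from the right: \<open>C / a\<close> bounds the signed sum over
    \<open>B\<close>, \<open>C\<close> passes to its subsets, and \<open>k\<close> pays for the
    multipliers.\<close>
  have "qnorm (coord_proj smul x xs A f) \<le> k * (C * (C / a)) * qnorm f"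
    if a: "0 < a" and f: "\<forall>n. norm (xs n f) \<le> 1" and A: "A \<subseteq> {n. norm (xs n f) \<ge> a}" for a f A
  proof -
    define B where "B = {n. norm (xs n f) \<ge> a}"
    define y where "y n = smul (sgn (xs n f)) (x n)" for n
    have B: "finite B" unfolding B_def by (rule finite_large_coefficients[OF basis a])
    have "qnorm (\<Sum>n\<in>B. y n) \<le> C / a * qnorm f"
    proof (cases "B = {}")
      case True
      then show ?thesis using a \<open>C \<ge> 0\<close> by (simp add: qnorm_nonneg)
    next
      case False
      define \<mu> where "\<mu> = Min ((\<lambda>n. norm (xs n f)) ` B)"
      have "a \<le> \<mu>" unfolding \<mu>_def using False B by (auto simp: B_def)
      \<comment> \<open>Coefficients outside \<open>B\<close> are below the threshold
        \<open>a\<close>.\<close>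
      have "greedy_set xs f (card B) B" using B by (auto simp: greedy_set_def B_def)
      from C[OF this] have "\<mu> * qnorm (\<Sum>n\<in>B. y n) \<le> C * qnorm f"
        using \<open>a \<le> \<mu>\<close> a by (simp add: restricted_truncation_def \<mu>_def y_def qnorm_scale)
      moreover have "a * qnorm (\<Sum>n\<in>B. y n) \<le> \<mu> * qnorm (\<Sum>n\<in>B. y n)"
        using \<open>a \<le> \<mu>\<close> by (intro mult_right_mono qnorm_nonneg)
      ultimately show ?thesis using a by (simp add: field_simps)
    qed
    then have CB: "C * qnorm (\<Sum>n\<in>B. y n) \<le> C * (C / a * qnorm f)"
      using \<open>C \<ge> 0\<close> by (rule mult_left_mono)
    have "qnorm (\<Sum>n\<in>E. y n) \<le> C * (C / a * qnorm f)" if "E \<subseteq> A" for E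
    proof -
      have "qnorm (\<Sum>n\<in>E. y n) \<le> C * qnorm (\<Sum>n\<in>B. y n)"
        unfolding y_def
      proof (rule truncation_bound_signed_sum_subset[OF basis C B])
        show "E \<subseteq> B" using that A by (simp add: B_def)
        show "norm (sgn (xs n f)) = 1" if "n \<in> B" for n
          using that a by (auto simp: B_def norm_sgn)
      qed (use \<open>C \<ge> 0\<close> in auto)
      then show ?thesis using CB by linarith
    qed
    \<comment> \<open>The multipliers are the moduli of the coefficients, in [0, 1] by
      \<open>f\<close>; times their signs they give back the coefficients.\<close>
    then have "qnorm (\<Sum>n\<in>A. smul (of_real (norm (xs n f))) (y n)) \<le> k * (C * (C / a * qnorm f))"
      using f A B
      by (intro mult[THEN spec, THEN spec, THEN spec, THEN spec, THEN mp, THEN mp, THEN mp])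
         (auto simp: B_def intro: finite_subset)
    moreover have "smul (of_real (norm (xs n f))) (y n) = smul (xs n f) (x n)" for n
      by (cases "xs n f = 0") (auto simp: y_def sgn_div_norm scaleR_conv_of_real)
    ultimately show ?thesis by (simp add: coord_proj_def mult.assoc)
  qed
  then show ?thesis unfolding nearly_unconditional_def by blast
qed

end
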